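(* The sequence of derangement numbers $\{d_n\}_{n\geq 3}$ is asymptotically infinitely log-monotonic; that is, for every positive integer $k$ there exists a positive integer $N$ such that for every integer $r$ with $0\leq r\leq k$, the sequence $R^r\{d_n\}_{n\geq N}$ is log-concave if $r$ is odd and log-convex if $r$ is even.
   Context: The derangement number $d_n$ is the number of permutations of $\{1,\dots,n\}$ without fixed points. The operator $R$ maps a sequence of positive numbers $\{z_n\}_{n\geq N}$ to $R\{z_n\}_{n\geq N}=\{z_{n+1}/z_n\}_{n\geq N}$, and $R^r$ is its $r$-fold iterate ($R^0$ is the identity). A sequence of positive numbers $\{z_n\}_{n\geq N}$ is log-concave (resp. log-convex) if $z_{n-1}z_{n+1}\leq z_n^2$ (resp. $z_{n-1}z_{n+1}\geq z_n^2$) for all $n\geq N+1$. *)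

theory Defs
  imports Complex_Main "HOL-Combinatorics.Permutations"
begin

text \<open>
  A sequence \<open>{z\<^sub>n}\<close> indexed by \<open>n \<ge> N\<close> is represented by a function \<open>z :: nat \<Rightarrow> real\<close> together
  with the starting index \<open>N\<close>; the values of \<open>z\<close> below \<open>N\<close> are never looked at.  The ratio
  operator does not shift the starting index, so \<open>(R ^^ r) z\<close> started at \<open>N\<close> is the \<open>r\<close>-fold
  iterate applied to the sequence \<open>z\<close> started at \<open>N\<close>.
\<close>

definition derangement_number :: "nat \<Rightarrow> nat" where
  "derangement_number n = card {p. p permutes {1..n} \<and> (\<forall>i\<in>{1..n}. p i \<noteq> i)}"

definition R :: "(nat \<Rightarrow> real) \<Rightarrow> nat \<Rightarrow> real" where
  "R z = (\<lambda>n. z (n + 1) / z n)"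

definition positive_from :: "nat \<Rightarrow> (nat \<Rightarrow> real) \<Rightarrow> bool" where
  "positive_from N z \<longleftrightarrow> (\<forall>n\<ge>N. z n > 0)"

text \<open>
  Log-concavity and log-convexity are notions for sequences of positive numbers, so positivity
  is part of both definitions.
\<close>

definition log_concave_from :: "nat \<Rightarrow> (nat \<Rightarrow> real) \<Rightarrow> bool" where
  "log_concave_from N z \<longleftrightarrow>
     positive_from N z \<and> (\<forall>n\<ge>N + 1. z (n - 1) * z (n + 1) \<le> (z n)\<^sup>2)"

definition log_convex_from :: "nat \<Rightarrow> (nat \<Rightarrow> real) \<Rightarrow> bool" where
  "log_convex_from N z \<longleftrightarrow>
     positive_from N z \<and> (\<forall>n\<ge>N + 1. z (n - 1) * z (n + 1) \<ge> (z n)\<^sup>2)"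

text \<open>
  For a sequence that starts at \<open>m\<close>, the index \<open>N\<close> selects one of its tails, whence \<open>m \<le> N\<close>.
\<close>

definition asymptotically_infinitely_log_monotonic_from :: "nat \<Rightarrow> (nat \<Rightarrow> real) \<Rightarrow> bool" where
  "asymptotically_infinitely_log_monotonic_from m z \<longleftrightarrow>
     (\<forall>k\<ge>1. \<exists>N\<ge>1. m \<le> N \<and>
        (\<forall>r\<le>k. (odd r \<longrightarrow> log_concave_from N ((R ^^ r) z)) \<and>
               (even r \<longrightarrow> log_convex_from N ((R ^^ r) z))))"

end

theory Submission
  imports Defs "HOL-Real_Asymp.Real_Asymp"
begin

text \<open>
  Taking logarithms turns \<open>R\<close> into the forward difference operator, so the claim is that
  \<open>(-1)\<^sup>r\<close> times the \<open>(r+2)\<close>-nd difference of \<open>ln d\<^sub>n\<close> is eventually nonnegative.  Write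
  \<open>d\<^sub>n = n! S\<^sub>n\<close>, where \<open>S\<^sub>n\<close> is the \<open>n\<close>-th partial sum of the series of \<open>1/e\<close>.  The first
  difference of \<open>ln d\<^sub>n\<close> is then \<open>ln (n + 1)\<close> plus an error of size \<open>O(1/(n+1)!)\<close>.  By the mean
  value theorem, the \<open>(r+1)\<close>-st difference of the logarithm is \<open>(-1)\<^sup>r r! / \<xi>\<^bsup>r+1\<^esup>\<close> with
  \<open>\<xi> \<le> n + r + 2\<close>.  It has the right sign and is only polynomially small, so it dominates the
  differences of the error.
\<close>

section \<open>Forward differences\<close>

text \<open>The polymorphic index lets the same operator act on sequences over \<open>nat\<close>
  and on functions of a real variable; the mean value theorem applies to the latter, and
  \<open>funpow_forward_diff_of_nat\<close> carries the result back.\<close>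

definition forward_diff :: "('a::{plus,one} \<Rightarrow> real) \<Rightarrow> 'a \<Rightarrow> real" where
  "forward_diff f = (\<lambda>x. f (x + 1) - f x)"

lemma funpow_Suc_forward_diff:
  "(forward_diff ^^ Suc m) f x = (forward_diff ^^ m) f (x + 1) - (forward_diff ^^ m) f x"
  by (simp add: forward_diff_def)

lemma funpow_forward_diff_add:
  "(forward_diff ^^ m) (\<lambda>x. f x + g x) = (\<lambda>x. (forward_diff ^^ m) f x + (forward_diff ^^ m) g x)"
  by (induction m) (auto simp: forward_diff_def fun_eq_iff)

lemma funpow_forward_diff_of_nat:
  "(forward_diff ^^ m) (\<lambda>n::nat. f (real n + c)) n = (forward_diff ^^ m) f (real n + c)"
  by (induction m arbitrary: n) (simp_all add: funpow_Suc_forward_diff add_ac del: funpow.simps(2))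

lemma funpow_forward_diff_cong:
  fixes f g :: "nat \<Rightarrow> real"
  assumes "\<And>j. j \<ge> n \<Longrightarrow> f j = g j"
  shows "(forward_diff ^^ m) f n = (forward_diff ^^ m) g n"
  using assms by (induction m arbitrary: n) (simp_all add: funpow_Suc_forward_diff del: funpow.simps(2))

lemma abs_funpow_forward_diff_le:
  fixes f :: "nat \<Rightarrow> real"
  assumes "\<And>j. j \<ge> n \<Longrightarrow> \<bar>f j\<bar> \<le> B"
  shows "\<bar>(forward_diff ^^ m) f n\<bar> \<le> 2 ^ m * B"
  using assms
proof (induction m arbitrary: n)
  case 0
  then show ?case by simp
next
  case (Suc m)
  have "\<bar>(forward_diff ^^ m) f (n + 1)\<bar> \<le> 2 ^ m * B" "\<bar>(forward_diff ^^ m) f n\<bar> \<le> 2 ^ m * B"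
    using Suc by auto
  then show ?case unfolding funpow_Suc_forward_diff by (simp add: abs_le_iff)
qed

text \<open>Here \<open>F i\<close> plays the role of the \<open>i\<close>-th derivative of
  \<open>F 0\<close>. Differencing every member of the family gives another such family, so the
  induction varies \<open>F\<close>; the last difference is removed by the ordinary mean value
  theorem on [\<xi>, \<xi> + 1], which moves the point by less than 1.\<close>

lemma funpow_forward_diff_mean_value:
  fixes F :: "nat \<Rightarrow> real \<Rightarrow> real"
  assumes "x > 0"
    and "\<And>i y. y > 0 \<Longrightarrow> (F i has_real_derivative F (Suc i) y) (at y)"
  shows "\<exists>\<xi>\<ge>x. \<xi> \<le> x + real p \<and> (forward_diff ^^ p) (F 0) x = F p \<xi>"
  using assms(2)
proof (induction p arbitrary: F)
  case 0
  then show ?case by auto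
next
  case (Suc p)
  define G where "G i = forward_diff (F i)" for i
  have "(G i has_real_derivative G (Suc i) y) (at y)" if "y > 0" for i y
  proof -
    have "((\<lambda>y. F i (y + 1)) has_real_derivative F (Suc i) (y + 1)) (at y)"
      using Suc.prems[of "y + 1" i] that by (simp add: DERIV_shift)
    then show ?thesis
      unfolding G_def forward_diff_def using Suc.prems[of y i] that
      by (intro DERIV_diff) auto
  qed
  from Suc.IH[of G, OF this] obtain \<xi> where
    \<xi>: "\<xi> \<ge> x" "\<xi> \<le> x + real p" "(forward_diff ^^ p) (G 0) x = G p \<xi>" by blast
  have "\<exists>z>\<xi>. z < \<xi> + 1 \<and> F p (\<xi> + 1) - F p \<xi> = (\<xi> + 1 - \<xi>) * F (Suc p) z"
    using \<xi>(1) \<open>x > 0\<close> by (intro MVT2 Suc.prems) auto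
  then obtain z where "z > \<xi>" "z < \<xi> + 1" "G p \<xi> = F (Suc p) z"
    by (auto simp: G_def forward_diff_def)
  with \<xi> show ?case
    by (intro exI[of _ z]) (auto simp: G_def funpow_Suc_right simp del: funpow.simps)
qed

lemma funpow_forward_diff_ln:
  assumes "x > 0"
  shows "\<exists>\<xi>\<ge>x. \<xi> \<le> x + real (Suc p) \<and>
           (forward_diff ^^ Suc p) ln x = (-1) ^ p * fact p / \<xi> ^ Suc p"
proof -
  define F :: "nat \<Rightarrow> real \<Rightarrow> real" where
    \<comment> \<open>The closed form for the derivatives of \<open>ln\<close> starts with the first
      one, so index 0 is separate.\<close>
    "F i = (case i of 0 \<Rightarrow> ln | Suc j \<Rightarrow> (\<lambda>y. (-1) ^ j * fact j / y ^ Suc j))" for i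
  have "(F i has_real_derivative F (Suc i) y) (at y)" if "y > 0" for i y
  proof (cases i)
    case 0
    with that show ?thesis by (auto simp: F_def intro!: derivative_eq_intros)
  next
    case (Suc j)
    have "((\<lambda>y. y ^ Suc j) has_real_derivative real (Suc j) * y ^ j) (at y)"
      using DERIV_pow[of "Suc j" y UNIV] by (simp del: power_Suc)
    then have "((\<lambda>y. (-1) ^ j * fact j / y ^ Suc j) has_real_derivative
            (0 * y ^ Suc j - (-1) ^ j * fact j * (real (Suc j) * y ^ j)) / (y ^ Suc j * y ^ Suc j)) (at y)"
      using that by (intro DERIV_divide DERIV_const) auto
    also have "(0 * y ^ Suc j - (-1) ^ j * fact j * (real (Suc j) * y ^ j)) / (y ^ Suc j * y ^ Suc j)
        = (-1) ^ Suc j * fact (Suc j) / y ^ Suc (Suc j)"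
      using that by (simp add: field_simps)
    finally show ?thesis by (simp add: F_def Suc)
  qed
  from funpow_forward_diff_mean_value[OF assms, of F "Suc p", OF this]
  show ?thesis by (simp add: F_def del: funpow.simps)
qed

section \<open>The ratio operator\<close>

text \<open>Positivity goes through the same induction because it justifies splitting the logarithm
  of each quotient.\<close>

lemma funpow_R_ln:
  assumes "positive_from N z" "n \<ge> N"
  shows "(R ^^ r) z n > 0 \<and> ln ((R ^^ r) z n) = (forward_diff ^^ r) (\<lambda>n. ln (z n)) n"
  using assms(2)
proof (induction r arbitrary: n)
  case 0
  with assms(1) show ?case by (auto simp: positive_from_def)
next
  case (Suc r)
  from Suc.IH[of n] Suc.IH[of "n + 1"] Suc.prems show ?case
    unfolding funpow_Suc_forward_diff by (simp add: R_def ln_div)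
qed

lemma ln_log_convexity:
  fixes a b c :: real
  assumes "a > 0" "b > 0" "c > 0"
  shows "b\<^sup>2 \<le> a * c \<longleftrightarrow> 2 * ln b \<le> ln a + ln c" "a * c \<le> b\<^sup>2 \<longleftrightarrow> ln a + ln c \<le> 2 * ln b"
proof -
  have "ln (b\<^sup>2) = 2 * ln b" "ln (a * c) = ln a + ln c"
    using assms by (simp_all add: ln_mult ln_realpow)
  then show "b\<^sup>2 \<le> a * c \<longleftrightarrow> 2 * ln b \<le> ln a + ln c" "a * c \<le> b\<^sup>2 \<longleftrightarrow> ln a + ln c \<le> 2 * ln b"
    using assms by (metis ln_le_cancel_iff mult_pos_pos zero_less_power)+
qed

lemma funpow_R_log_monotonic:
  assumes pos: "positive_from N z"
    and diff: "\<And>n. n \<ge> N \<Longrightarrow> (-1) ^ r * (forward_diff ^^ (r + 2)) (\<lambda>n. ln (z n)) n \<ge> 0"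
  shows "(odd r \<longrightarrow> log_concave_from N ((R ^^ r) z)) \<and> (even r \<longrightarrow> log_convex_from N ((R ^^ r) z))"
proof -
  define w where "w = (R ^^ r) z"
  have w: "w n > 0" "ln (w n) = (forward_diff ^^ r) (\<lambda>n. ln (z n)) n" if "n \<ge> N" for n
    using funpow_R_ln[OF pos that] by (auto simp: w_def)
  \<comment> \<open>The bracket is the second difference of \<open>ln w\<close> based at
    \<open>n - 1\<close>; this accounts for both the order \<open>r + 2\<close> and the shift by
    one.\<close>
  have "(-1) ^ r * (ln (w (n - 1)) + ln (w (n + 1)) - 2 * ln (w n)) \<ge> 0" if "n \<ge> N + 1" for n
    using diff[of "n - 1"] that
    by (simp add: w funpow_Suc_forward_diff algebra_simps del: funpow.simps)
  moreover have "w (n - 1) > 0" "w n > 0" "w (n + 1) > 0" if "n \<ge> N + 1" for n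
    using that by (auto intro: w)
  ultimately show ?thesis
    unfolding w_def[symmetric] log_concave_from_def log_convex_from_def positive_from_def
    using w(1) by (fastforce simp: ln_log_convexity)
qed

section \<open>Derangement numbers\<close>

text \<open>A permutation of \<open>S\<close> is a derangement of exactly one subset of
  \<open>S\<close>, the set of points it moves. So (card S)! is the sum of the derangement counts
  over all subsets, and Moebius inversion on the subset lattice solves for them.\<close>

lemma card_derangements:
  fixes A :: "'a set"
  assumes "finite A"
  shows "real (card {p. p permutes A \<and> (\<forall>i\<in>A. p i \<noteq> i)}) =
           (\<Sum>T\<in>Pow A. (-1) ^ (card A - card T) * fact (card T))"
proof -
  define D where "D S = {p. p permutes S \<and> (\<forall>i\<in>S. p i \<noteq> i)}" for S :: "'a set"
  have "fact (card S) = (\<Sum>T\<in>Pow S. real (card (D T)))" if "finite S" for S :: "'a set"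
  proof -
    have support: "T = {x. p x \<noteq> x}" if "p \<in> D T" for p T
      using that permutes_not_in by (force simp: D_def)
    then have disjoint: "D T \<inter> D U = {}" if "T \<noteq> U" for T U
      using that by blast
    have fin: "finite (D T)" if "T \<subseteq> S" for T
      using finite_permutations[of T] finite_subset[OF that \<open>finite S\<close>] by (simp add: D_def)
    have "{p. p permutes S} = (\<Union>T\<in>Pow S. D T)"
    proof (intro subset_antisym subsetI)
      fix p assume "p \<in> {p. p permutes S}"
      then have "p permutes {x. p x \<noteq> x}" "{x. p x \<noteq> x} \<subseteq> S"
        by (auto intro: permutes_superset dest: permutes_not_in)
      then show "p \<in> (\<Union>T\<in>Pow S. D T)" by (auto simp: D_def)
    qed (auto simp: D_def intro: permutes_subset)
    then have "card {p. p permutes S} = (\<Sum>T\<in>Pow S. card (D T))"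
      using that fin disjoint by (subst card_UN_disjoint[symmetric]) simp_all
    then show ?thesis
      using card_permutations[OF refl that] by (metis of_nat_fact of_nat_sum)
  qed
  from inclusion_exclusion_mobius[of "\<lambda>S. fact (card S)", OF this assms]
  show ?thesis by (simp add: D_def)
qed

definition alternating_fact_sum :: "nat \<Rightarrow> real" where
  "alternating_fact_sum n = (\<Sum>k\<le>n. (-1) ^ k / fact k)"

lemma alternating_fact_sum_Suc:
  "alternating_fact_sum (Suc n) = alternating_fact_sum n + (-1) ^ Suc n / fact (Suc n)"
  by (simp add: alternating_fact_sum_def)

lemma derangement_number_eq:
  "real (derangement_number n) = fact n * alternating_fact_sum n"
proof -
  let ?h = "\<lambda>T. (-1) ^ (n - card T) * fact (card T) :: real"
  have "real (derangement_number n) = sum ?h (Pow {1..n})"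
    unfolding derangement_number_def by (subst card_derangements) auto
  also have "\<dots> = (\<Sum>k\<le>n. sum ?h {T \<in> Pow {1..n}. card T = k})"
    by (rule sum.group[symmetric]) (auto dest: card_mono[rotated])
  also have "\<dots> = (\<Sum>k\<le>n. real (n choose k) * ((-1) ^ (n - k) * fact k))"
    by (intro sum.cong) (simp_all add: n_subsets)
  also have "\<dots> = (\<Sum>k\<le>n. fact n * ((-1) ^ (n - k) / fact (n - k)))"
    by (intro sum.cong) (simp_all add: binomial_fact)
  also have "\<dots> = (\<Sum>k\<le>n. fact n * ((-1) ^ k / fact k))"
    by (rule sum.reindex_bij_witness[of _ "\<lambda>k. n - k" "\<lambda>k. n - k"]) auto
  finally show ?thesis by (simp add: alternating_fact_sum_def sum_distrib_left)
qed

text \<open>The constant is the value at 3. Along odd indices the sums increase from there, and each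
  sum of even index exceeds the next one. The value at 1 is 0, hence
  \<open>n \<ge> 2\<close>.\<close>

lemma alternating_fact_sum_ge:
  assumes "n \<ge> 2"
  shows "alternating_fact_sum n \<ge> 1 / 3"
proof -
  have odd: "alternating_fact_sum (2 * k + 3) \<ge> 1 / 3" for k
  proof (induction k)
    case 0
    show ?case by (simp add: alternating_fact_sum_def eval_nat_numeral)
  next
    case (Suc k)
    define m where "m = 2 * k + 3"
    have "odd m" by (simp add: m_def)
    have "1 / fact (Suc (Suc m)) \<le> (1 / fact (Suc m) :: real)"
      by (intro divide_left_mono fact_mono) auto
    moreover have "alternating_fact_sum (Suc (Suc m)) =
        alternating_fact_sum m + 1 / fact (Suc m) - 1 / fact (Suc (Suc m))"
      using \<open>odd m\<close> by (simp add: alternating_fact_sum_Suc del: fact_Suc)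
    moreover have "alternating_fact_sum m \<ge> 1 / 3"
      using Suc by (simp add: m_def)
    ultimately have "alternating_fact_sum (Suc (Suc m)) \<ge> 1 / 3" by linarith
    moreover have "2 * Suc k + 3 = Suc (Suc m)" by (simp add: m_def)
    ultimately show ?case by (simp only:)
  qed
  show ?thesis
  proof (cases "even n")
    case True
    then obtain j where "n = 2 * j" by (elim evenE)
    with assms obtain k where "n = 2 * k + 2" by (cases j) auto
    then have "Suc n = 2 * k + 3" by simp
    then have "alternating_fact_sum (Suc n) \<ge> 1 / 3" using odd[of k] by metis
    moreover have "alternating_fact_sum n = alternating_fact_sum (Suc n) + 1 / fact (Suc n)"
      using True by (simp add: alternating_fact_sum_Suc del: fact_Suc)
    ultimately show ?thesis by (simp del: fact_Suc add: add_increasing2)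
  next
    case False
    then obtain j where "n = 2 * j + 1" by (elim oddE)
    with assms obtain k where "n = 2 * k + 3" by (cases j) auto
    with odd[of k] show ?thesis by simp
  qed
qed

section \<open>Size of the error term and comparison with the main term\<close>

lemma abs_ln_diff_le:
  fixes x y c :: real
  assumes "c > 0" "x \<ge> c" "y \<ge> c"
  shows "\<bar>ln x - ln y\<bar> \<le> \<bar>x - y\<bar> / c"
proof -
  have "ln u - ln v \<le> \<bar>u - v\<bar> / c" if "u \<ge> c" "v \<ge> c" for u v
  proof -
    have "ln u - ln v \<le> (u - v) / v"
      using assms that by (intro ln_diff_le) auto
    also have "\<dots> \<le> \<bar>u - v\<bar> / c"
      using assms that by (intro frac_le) auto
    finally show ?thesis .
  qed
  from this[of x y] this[of y x] assms show ?thesis by (simp add: abs_minus_commute abs_le_iff)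
qed

text \<open>Consecutive partial sums differ by exactly 1/(n+1)! in absolute value, and 3 is the
  Lipschitz constant of \<open>ln\<close> above 1/3.\<close>

lemma abs_ln_alternating_fact_sum_diff_le:
  assumes "n \<ge> 2"
  shows "\<bar>forward_diff (\<lambda>n. ln (alternating_fact_sum n)) n\<bar> \<le> 3 / fact (n + 1)"
proof -
  have "\<bar>forward_diff (\<lambda>n. ln (alternating_fact_sum n)) n\<bar>
      \<le> \<bar>alternating_fact_sum (n + 1) - alternating_fact_sum n\<bar> / (1 / 3)"
    unfolding forward_diff_def using assms
    by (intro abs_ln_diff_le alternating_fact_sum_ge) auto
  also have "\<dots> = 3 / fact (n + 1)"
    by (simp add: alternating_fact_sum_Suc power_abs del: fact_Suc)
  finally show ?thesis .
qed

text \<open>The powers of 2 are interposed: they eventually exceed any polynomial and stay below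
  \<open>fact n\<close>, since the terms of the exponential series at 2 tend to 0.\<close>

lemma eventually_polynomial_le_fact:
  fixes b c :: real
  shows "\<forall>\<^sub>F n in sequentially. c * (real n + b) ^ m \<le> fact (n + 1)"
proof -
  have "(\<lambda>n. inverse (fact n) * 2 ^ n :: real) \<longlonglongrightarrow> 0"
    by (rule summable_LIMSEQ_zero[OF summable_exp])
  then have "\<forall>\<^sub>F n in sequentially. inverse (fact n) * 2 ^ n < (1 :: real)"
    by (rule order_tendstoD) simp
  moreover have "(\<lambda>n. c * (real n + b) ^ m / 2 ^ n) \<longlonglongrightarrow> 0"
    by real_asymp
  then have "\<forall>\<^sub>F n in sequentially. c * (real n + b) ^ m / 2 ^ n < 1"
    by (rule order_tendstoD) simp
  ultimately show ?thesis
  proof eventually_elim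
    case (elim n)
    then have "c * (real n + b) ^ m \<le> 2 ^ n" "2 ^ n \<le> (fact n :: real)"
      by (simp_all add: field_simps)
    moreover have "(fact n :: real) \<le> fact (n + 1)" by (intro fact_mono) auto
    ultimately show ?case by linarith
  qed
qed

lemma eventually_forward_diff_ln_derangement_number:
  "\<forall>\<^sub>F n in sequentially.
     (-1) ^ r * (forward_diff ^^ (r + 2)) (\<lambda>n. ln (real (derangement_number n))) n \<ge> 0"
  \<comment> \<open>The constants are those obtained by clearing denominators in 2^(r+1) * 3 /
    (n+1)! \<le> r! / (n+r+2)^(r+1): the error bound on the left, the least possible size of the
    main term on the right.\<close>
  using eventually_polynomial_le_fact[of "2 ^ (r + 1) * 3 / fact r" "real r + 2" "r + 1"]
    eventually_ge_at_top[of 2]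
proof eventually_elim
  case (elim n)
  define e where "e = forward_diff (\<lambda>n. ln (alternating_fact_sum n))"
  \<comment> \<open>The innermost difference is taken first: it turns the factorial into ln (j + 1),
    leaving \<open>r + 1\<close> differences for main term and error.\<close>
  have "forward_diff (\<lambda>n. ln (real (derangement_number n))) j = ln (real j + 1) + e j"
    if "j \<ge> n" for j
    using elim(2) that alternating_fact_sum_ge[of j] alternating_fact_sum_ge[of "j + 1"]
    by (simp add: forward_diff_def e_def derangement_number_eq ln_mult add_ac)
  then have "(forward_diff ^^ Suc r) (forward_diff (\<lambda>n. ln (real (derangement_number n)))) n =
      (forward_diff ^^ Suc r) (\<lambda>j. ln (real j + 1) + e j) n"
    by (rule funpow_forward_diff_cong)
  also have "\<dots> = (forward_diff ^^ Suc r) ln (real n + 1) + (forward_diff ^^ Suc r) e n"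
    unfolding funpow_forward_diff_add funpow_forward_diff_of_nat ..
  finally have split: "(forward_diff ^^ (r + 2)) (\<lambda>n. ln (real (derangement_number n))) n = \<dots>"
    by (simp only: add_2_eq_Suc' funpow_Suc_right o_apply)
  obtain \<xi> where \<xi>: "\<xi> \<ge> real n + 1" "\<xi> \<le> real n + 1 + real (Suc r)"
    "(forward_diff ^^ Suc r) ln (real n + 1) = (-1) ^ r * fact r / \<xi> ^ Suc r"
    using funpow_forward_diff_ln[of "real n + 1" r] by auto
  have "\<bar>e j\<bar> \<le> 3 / fact (n + 1)" if "j \<ge> n" for j
  proof -
    have "\<bar>e j\<bar> \<le> 3 / fact (j + 1)"
      unfolding e_def using elim(2) that by (intro abs_ln_alternating_fact_sum_diff_le) auto
    also have "\<dots> \<le> 3 / fact (n + 1)"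
      using that by (intro divide_left_mono fact_mono) auto
    finally show ?thesis .
  qed
  then have "\<bar>(forward_diff ^^ Suc r) e n\<bar> \<le> 2 ^ Suc r * (3 / fact (n + 1))"
    by (rule abs_funpow_forward_diff_le)
  also have "\<dots> \<le> fact r / (real n + (real r + 2)) ^ Suc r"
  proof -
    have "(real n + (real r + 2)) ^ Suc r > 0" by (intro zero_less_power) simp
    with elim(1) show ?thesis
      by (simp add: field_simps del: fact_Suc power_Suc)
  qed
  also have "\<dots> \<le> fact r / \<xi> ^ Suc r"
    using \<xi> by (intro divide_left_mono power_mono mult_pos_pos zero_less_power) auto
  finally have error: "\<bar>(forward_diff ^^ Suc r) e n\<bar> \<le> fact r / \<xi> ^ Suc r" .
  have "(-1) ^ r * ((-1) ^ r * fact r / \<xi> ^ Suc r + (forward_diff ^^ Suc r) e n) =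
      fact r / \<xi> ^ Suc r + (-1) ^ r * (forward_diff ^^ Suc r) e n"
    by (simp add: distrib_left mult.assoc[symmetric] power_mult_distrib[symmetric] del: funpow.simps power_Suc)
  also have "\<dots> \<ge> 0"
    using error by (cases "even r") (auto simp: abs_le_iff simp del: funpow.simps power_Suc)
  finally show ?case unfolding split \<xi>(3) .
qed

theorem theorem4p5:
  shows "asymptotically_infinitely_log_monotonic_from 3 (\<lambda>n. real (derangement_number n))"
  unfolding asymptotically_infinitely_log_monotonic_from_def
proof (intro allI impI)
  fix k :: nat
  let ?d = "\<lambda>n. real (derangement_number n)"
  \<comment> \<open>Only finitely many \<open>r\<close> occur, so their thresholds have a common
    bound.\<close>
  have "\<forall>\<^sub>F n in sequentially. \<forall>r\<in>{..k}. (-1) ^ r * (forward_diff ^^ (r + 2)) (\<lambda>n. ln (?d n)) n \<ge> 0"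
    by (intro eventually_ball_finite ballI eventually_forward_diff_ln_derangement_number) auto
  then obtain M where M: "\<And>n r. n \<ge> M \<Longrightarrow> r \<le> k \<Longrightarrow>
      (-1) ^ r * (forward_diff ^^ (r + 2)) (\<lambda>n. ln (?d n)) n \<ge> 0"
    unfolding eventually_sequentially by blast
  define N where "N = max M 3"
  have "?d n > 0" if "n \<ge> N" for n
    unfolding derangement_number_eq using alternating_fact_sum_ge[of n] that
    by (intro mult_pos_pos) (auto simp: N_def)
  then have "positive_from N ?d" by (simp add: positive_from_def)
  then have "\<forall>r\<le>k. (odd r \<longrightarrow> log_concave_from N ((R ^^ r) ?d)) \<and> (even r \<longrightarrow> log_convex_from N ((R ^^ r) ?d))"
    by (intro allI impI funpow_R_log_monotonic M) (auto simp: N_def)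
  then show "\<exists>N\<ge>1. 3 \<le> N \<and> (\<forall>r\<le>k. (odd r \<longrightarrow> log_concave_from N ((R ^^ r) ?d)) \<and>
      (even r \<longrightarrow> log_convex_from N ((R ^^ r) ?d)))"
    by (intro exI[of _ N]) (auto simp: N_def)
qed

end
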